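(* Let $\mathbf M$ be the transition matrix of an $m$-state Markov chain such that $\mathbf M=v\mathbf 1^\top+\mathbf C$, where $\mathbf C$ is a matrix with strictly positive entries and columns summing to $1-\lambda$, and $v$ is a vector with strictly positive entries summing to $\lambda$. Then, if $\pi$ is the stationary distribution of $\mathbf M$, there exist, for each $i\in[m]$, a (non-empty) finite set $F_i$, and with $F=\bigcup_i F_i$, corresponding parameters $b_j\in\{0,1\}$, $0\le p_j\le m-2$, an index $q_j\in[m]$, and a set $S_j$ of index pairs with $|S_j|=m-p_j-b_j-1$, for each $j\in F_i$, such that $$\pi[i]=\frac{\sum_{j\in F_i}\lambda^{p_j+1}\,(v[q_j])^{b_j}\prod_{(s,w)\in S_j}\mathbf C[(s,w)]}{\sum_{j\in F}C_j\,\lambda^{p_j+b_j}\prod_{(s,w)\in S_j}\mathbf C[(s,w)]},$$ where $C_j=C_j(m)$ is a positive parameter.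
   Context: Here $[m]=\{1,\dots,m\}$. Transition matrices are column-stochastic (nonnegative entries, every column summing to $1$), and the stationary distribution is the probability vector $\pi$ with $\mathbf M\pi=\pi$. $\mathbf 1$ is the all-ones vector in $\mathbb R^m$, $v[k]$ and $\pi[k]$ denote $k$-th coordinates, and $\mathbf C[(s,w)]$ is the entry of $\mathbf C$ indexed by the pair $(s,w)\in[m]\times[m]$. The notation $C_j(m)$ indicates a quantity depending on $m$; it does not depend on the entries of $v$ and $\mathbf C$.
   Formalization: The printed formula is off by a factor λ (uniform v and C with λ→0 contradict it), so each denominator coefficient C_j is replaced by λ·c_j with c_j>0 depending only on m; m≥2 is assumed, since 0≤p_j≤m−2 is impossible for m=1. *)

theory Defs
  imports "HOL-Analysis.Analysis"
begin

(* Entry M $ s $ w is the probability of moving from state w to state s. *)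
definition transition_matrix :: "real ^ 'm ^ 'm \<Rightarrow> bool" where
  "transition_matrix M \<longleftrightarrow> (\<forall>s w. 0 \<le> M $ s $ w) \<and> (\<forall>w. (\<Sum>s\<in>UNIV. M $ s $ w) = 1)"

definition probability_vector :: "real ^ 'm \<Rightarrow> bool" where
  "probability_vector x \<longleftrightarrow> (\<forall>i. 0 \<le> x $ i) \<and> (\<Sum>i\<in>UNIV. x $ i) = 1"

definition stationary_distribution :: "real ^ 'm ^ 'm \<Rightarrow> real ^ 'm \<Rightarrow> bool" where
  "stationary_distribution M x \<longleftrightarrow> probability_vector x \<and> M *v x = x"

end

theory Submission
  imports Defs
begin

text \<open>
  The stationary equation reads \<open>(I - C) \<pi> = v\<close>, and \<open>I - C\<close> is \<open>\<lambda>\<close> times the identity plus the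
  Laplacian of \<open>C\<close>. By the matrix forest theorem \<open>\<pi> $ i\<close> is therefore the sum of
  \<open>v $ s * \<lambda> ^ (k - 1) * w\<close> over the states \<open>s\<close> and the spanning rooted forests in which
  \<open>s\<close> lies in the tree rooted at \<open>i\<close>, divided by the sum of \<open>\<lambda> ^ k * w\<close> over all forests; here \<open>k\<close>
  is the number of trees and \<open>w\<close> the product of the entries of \<open>C\<close> along the edges. For \<open>k = 1\<close> every
  state has the same root, so the factors \<open>v $ s\<close> sum to \<open>\<lambda>\<close> (\<open>b = 0\<close>); for \<open>k \<ge> 2\<close> they are
  kept (\<open>b = 1\<close>), and each forest occurs once per state \<open>s\<close>, whence \<open>c = 1 / m\<close>.
\<close>

section \<open>Rooted forests as parent maps\<close>

text \<open>A rooted forest is encoded by its parent map, the roots being the fixed points.\<close>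

definition reaches :: "('a \<Rightarrow> 'a) \<Rightarrow> 'a \<Rightarrow> 'a \<Rightarrow> bool" where
  "reaches f w s \<longleftrightarrow> (\<exists>n. (f ^^ n) w = s)"

definition root_of :: "('a \<Rightarrow> 'a) \<Rightarrow> 'a \<Rightarrow> 'a \<Rightarrow> bool" where
  "root_of f w r \<longleftrightarrow> reaches f w r \<and> f r = r"

definition forest :: "('a \<Rightarrow> 'a) \<Rightarrow> bool" where
  "forest f \<longleftrightarrow> (\<forall>w. \<exists>r. root_of f w r)"

definition roots :: "('a \<Rightarrow> 'a) \<Rightarrow> 'a set" where
  "roots f = {w. f w = w}"

text \<open>Pairs are (parent, child), matching the index order (target, source) of matrix
  entries.\<close>

definition edges :: "('a \<Rightarrow> 'a) \<Rightarrow> ('a \<times> 'a) set" where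
  "edges f = (\<lambda>w. (f w, w)) ` (- roots f)"

text \<open>A root \<open>r\<close> contributes the diagonal entry \<open>a r r\<close>, so roots
  carry weights as well as edges.\<close>

definition forest_weight :: "('a \<Rightarrow> 'a \<Rightarrow> 'b) \<Rightarrow> ('a::finite \<Rightarrow> 'a) \<Rightarrow> 'b::comm_monoid_mult" where
  "forest_weight a f = (\<Prod>w\<in>UNIV. a w (f w))"

lemma reaches_refl [simp]: "reaches f w w"
  unfolding reaches_def by (rule exI[of _ 0]) simp

lemma funpow_fixpoint: "f r = r \<Longrightarrow> (f ^^ n) r = r"
  by (induction n) auto

lemma reaches_fixpoint: "f r = r \<Longrightarrow> reaches f r s \<longleftrightarrow> s = r"
  by (auto simp: reaches_def funpow_fixpoint)

lemma reaches_trans: "reaches f u w \<Longrightarrow> reaches f w s \<Longrightarrow> reaches f u s"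
  unfolding reaches_def by (metis comp_apply funpow_add)

lemma reaches_step: "reaches f w (f w)"
  unfolding reaches_def by (rule exI[of _ 1]) simp

text \<open>Both states are iterates of \<open>u\<close>, so the later one is reached from the
  earlier one.\<close>

lemma reaches_linear: "reaches f u s \<Longrightarrow> reaches f u r \<Longrightarrow> reaches f s r \<or> reaches f r s"
proof -
  have *: "reaches f ((f ^^ m) u) ((f ^^ n) u)" if "m \<le> n" for m n
    unfolding reaches_def using that by (intro exI[of _ "n - m"]) (simp flip: funpow_add comp_apply[of "f ^^ _"])
  assume "reaches f u s" "reaches f u r"
  thus ?thesis using * nat_le_linear unfolding reaches_def[of f u] by blast
qed

lemma root_of_reaches:
  assumes "reaches f w s"
  shows "root_of f w r \<longleftrightarrow> root_of f s r"
  using assms reaches_linear[of f w s r] reaches_trans[of f w s r] reaches_fixpoint[of f r s]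
  by (auto simp: root_of_def)

lemma root_of_unique: "root_of f w r \<Longrightarrow> root_of f w r' \<Longrightarrow> r = r'"
  by (metis reaches_fixpoint root_of_def root_of_reaches)

lemma root_of_root: "f r = r \<Longrightarrow> root_of f r i \<longleftrightarrow> i = r"
  by (auto simp: root_of_def reaches_fixpoint)

lemma root_of_step: "root_of f (f w) r \<longleftrightarrow> root_of f w r"
  using root_of_reaches[OF reaches_step] by metis

text \<open>A cycle through \<open>s\<close> of length \<open>Suc n\<close>, run \<open>l\<close>
  times, takes at least \<open>l\<close> steps; by then the path from \<open>s\<close> has stopped
  at its root, so \<open>s\<close> is that root.\<close>

lemma forest_acyclic:
  assumes "forest f" "reaches f (f s) s"
  shows "f s = s"
proof -
  obtain r l where r: "f r = r" "(f ^^ l) s = r"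
    using assms(1) unfolding forest_def root_of_def reaches_def by metis
  obtain n where "(f ^^ n) (f s) = s"
    using assms(2) by (auto simp: reaches_def)
  hence "(f ^^ Suc n) s = s"
    by (simp add: funpow_swap1)
  hence "((f ^^ Suc n) ^^ l) s = s"
    by (rule funpow_fixpoint)
  hence "(f ^^ (n * l + l)) s = s"
    by (simp only: funpow_mult) (simp add: algebra_simps)
  hence "s = r"
    by (simp add: funpow_add r funpow_fixpoint)
  thus ?thesis using r by simp
qed

section \<open>Changing the parent of one state\<close>

lemma funpow_upd:
  assumes "\<not> reaches f w s"
  shows "((f(s := x)) ^^ n) w = (f ^^ n) w"
  using assms by (induction n) (auto simp: reaches_def)

text \<open>The parent of \<open>s\<close> is consulted only after \<open>s\<close> has been
  visited. Resetting it to \<open>f s\<close> undoes the update, which gives the converse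
  direction.\<close>

lemma reaches_upd: "reaches (f(s := x)) w s \<longleftrightarrow> reaches f w s"
proof -
  have *: "\<not> reaches (g(s := y)) w s" if "\<not> reaches g w s" for g y
    using that funpow_upd[OF that] by (auto simp: reaches_def)
  show ?thesis using *[of f x] *[of "f(s := x)" "f s"] by auto
qed

lemma root_of_upd:
  assumes "\<not> reaches f w s"
  shows "root_of (f(s := x)) w r \<longleftrightarrow> root_of f w r"
  using assms funpow_upd[OF assms, where x = x] by (auto simp: root_of_def reaches_def)

text \<open>States whose path avoids \<open>s\<close> keep their root. If \<open>x = s\<close>, then
  \<open>s\<close> becomes a root; otherwise the path from \<open>x\<close> avoids \<open>s\<close>,
  and \<open>s\<close> takes over the root of \<open>x\<close>. States that reach \<open>s\<close>
  share its root.\<close>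

lemma forest_upd:
  assumes "forest f" "x = s \<or> \<not> reaches f x s"
  shows "forest (f(s := x))"
proof -
  have *: "\<exists>r. root_of (f(s := x)) w r" if "\<not> reaches f w s" for w
    using assms(1) root_of_upd[OF that, of x] by (simp add: forest_def)
  have s: "\<exists>r. root_of (f(s := x)) s r"
  proof (cases "x = s")
    case True
    thus ?thesis by (intro exI[of _ s]) (simp add: root_of_def)
  next
    case False
    thus ?thesis using *[of x] assms(2) root_of_step[of "f(s := x)" s] by auto
  qed
  show ?thesis unfolding forest_def
    using * s reaches_upd[of f s x] root_of_reaches[of "f(s := x)" _ s] by blast
qed

text \<open>Only the factor at \<open>s\<close> changes; cross-multiplying avoids a division by
  \<open>a s (f s)\<close>.\<close>

lemma forest_weight_upd:
  "a s x * forest_weight a f = a s (f s) * forest_weight a (f(s := x))"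
proof -
  have "(\<Prod>w\<in>-{s}. a w ((f(s := x)) w)) = (\<Prod>w\<in>-{s}. a w (f w))"
    by (rule prod.cong) auto
  thus ?thesis
    unfolding forest_weight_def
    by (simp add: prod.remove[of UNIV s] Compl_eq_Diff_UNIV mult_ac del: fun_upd_apply)
       (simp add: mult_ac)
qed

section \<open>The matrix forest theorem\<close>

text \<open>
  Exchanging the parent of \<open>s\<close> with an extra target \<open>w\<close> is a weight-preserving involution on the
  pairs for which this creates no cycle; the other pairs are left fixed.
\<close>

lemma forest_first_step:
  fixes a :: "'a::finite \<Rightarrow> 'a \<Rightarrow> real"
  shows "(\<Sum>w\<in>UNIV. a s w) * (\<Sum>f | forest f \<and> root_of f s i. forest_weight a f)
       = (\<Sum>w\<in>-{s}. a s w * (\<Sum>f | forest f \<and> root_of f w i. forest_weight a f))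
         + (if i = s then a s s * (\<Sum>f | forest f. forest_weight a f) else 0)"
proof -
  define A where "A = {(w :: 'a, f). forest f \<and> root_of f s i}"
  \<comment> \<open>The slice \<open>w = s\<close> accounts for the last summand of the claim: it is
    empty unless \<open>i = s\<close>, and then it contains every forest.\<close>
  define B where "B = {(w, f). forest f \<and> (if w = s then i = s else root_of f w i)}"
  define T where "T = (\<lambda>(w, f). if w \<noteq> s \<and> reaches f w s then (w, f) else (f s, f(s := w)))"
  define W where "W = (\<lambda>(w, f). a s w * forest_weight a f)"
  have W: "W (T x) = W x" for x
    by (cases x) (simp add: W_def T_def forest_weight_upd[symmetric])
  have loop: "forest f \<Longrightarrow> reaches f (f s) s \<Longrightarrow> f s = s" for f
    by (rule forest_acyclic)
  \<comment> \<open>After a swap the extra target is \<open>f s\<close>. It reaches \<open>s\<close>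
    only if \<open>f s = s\<close>, since otherwise \<open>f\<close> would have a cycle; hence the
    second application swaps back.\<close>
  have TT: "T (T x) = x" if "x \<in> A \<union> B" for x
    using that loop reaches_upd[of "snd x" s] by (auto simp: A_def B_def T_def split: if_splits)
  have TA: "T x \<in> B" if "x \<in> A" for x
  proof -
    obtain w f where x: "x = (w, f)" "forest f" "root_of f s i"
      using \<open>x \<in> A\<close> by (auto simp: A_def)
    show ?thesis
    proof (cases "w \<noteq> s \<and> reaches f w s")
      case True
      thus ?thesis using x root_of_reaches[of f w s i] by (simp add: T_def B_def)
    next
      case False
      have "forest (f(s := w))" using x False by (intro forest_upd) auto
      \<comment> \<open>If \<open>s\<close> is a root of \<open>f\<close>, the new extra target is
        \<open>s\<close> itself, so the slice \<open>w = s\<close> is the relevant one.\<close>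
      moreover have "i = s" if "f s = s" using x that by (simp add: root_of_root)
      moreover have "root_of (f(s := w)) (f s) i" if "f s \<noteq> s"
        using x that loop by (subst root_of_upd) (auto simp: root_of_step)
      ultimately show ?thesis using False x by (auto simp: T_def B_def)
    qed
  qed
  have TB: "T x \<in> A" if "x \<in> B" for x
  proof -
    obtain w f where x: "x = (w, f)" "forest f" "if w = s then i = s else root_of f w i"
      using \<open>x \<in> B\<close> by (auto simp: B_def)
    show ?thesis
    proof (cases "w \<noteq> s \<and> reaches f w s")
      case True
      thus ?thesis using x root_of_reaches[of f w s i] by (simp add: T_def A_def)
    next
      case False
      have "forest (f(s := w))" using x False by (intro forest_upd) auto
      moreover have "root_of (f(s := w)) s i"
      proof (cases "w = s")
        case True
        thus ?thesis using x by (simp add: root_of_root)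
      next
        case neq: False
        hence "root_of (f(s := w)) w i" using x False by (simp add: root_of_upd)
        thus ?thesis using root_of_step[of "f(s := w)" s i] by simp
      qed
      ultimately show ?thesis using False x by (auto simp: T_def A_def)
    qed
  qed
  have "sum W A = sum W B"
    by (rule sum.reindex_bij_witness[of _ T T]) (auto simp: TT TA TB W)
  moreover have "sum W A = (\<Sum>w\<in>UNIV. a s w) * (\<Sum>f | forest f \<and> root_of f s i. forest_weight a f)"
  proof -
    have "A = UNIV \<times> {f. forest f \<and> root_of f s i}" by (auto simp: A_def)
    thus ?thesis by (simp add: sum_product sum.cartesian_product W_def)
  qed
  moreover have "sum W B = (\<Sum>w\<in>-{s}. a s w * (\<Sum>f | forest f \<and> root_of f w i. forest_weight a f))
         + (if i = s then a s s * (\<Sum>f | forest f. forest_weight a f) else 0)"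
  proof -
    let ?X = "\<lambda>w. {f. forest f \<and> (if w = s then i = s else root_of f w i)}"
    have "B = Sigma UNIV ?X" by (auto simp: B_def)
    hence "sum W B = (\<Sum>w\<in>UNIV. \<Sum>f\<in>?X w. a s w * forest_weight a f)"
      by (simp add: sum.Sigma W_def)
    also have "\<dots> = (\<Sum>w\<in>-{s}. \<Sum>f\<in>?X w. a s w * forest_weight a f)
        + (\<Sum>f\<in>?X s. a s s * forest_weight a f)"
      by (subst sum.remove[of UNIV s]) (auto simp: Compl_eq_Diff_UNIV)
    also have "(\<Sum>w\<in>-{s}. \<Sum>f\<in>?X w. a s w * forest_weight a f)
        = (\<Sum>w\<in>-{s}. a s w * (\<Sum>f | forest f \<and> root_of f w i. forest_weight a f))"
      by (intro sum.cong) (auto simp: sum_distrib_left)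
    also have "(\<Sum>f\<in>?X s. a s s * forest_weight a f)
        = (if i = s then a s s * (\<Sum>f | forest f. forest_weight a f) else 0)"
      by (simp add: sum_distrib_left)
    finally show ?thesis .
  qed
  ultimately show ?thesis by simp
qed

text \<open>By \<open>forest_first_step\<close> the forest sums solve the transpose of the system
  for \<open>x\<close>, with a source at \<open>i\<close> only. Pairing the two systems cancels the
  off-diagonal sums and leaves the term with \<open>x i\<close>.\<close>

lemma matrix_forest:
  fixes a :: "'a::finite \<Rightarrow> 'a \<Rightarrow> real" and x v :: "'a \<Rightarrow> real"
  assumes eq: "\<And>s. (\<Sum>w\<in>UNIV. a s w) * x s = v s + (\<Sum>w\<in>-{s}. a w s * x w)"
  shows "a i i * (\<Sum>f | forest f. forest_weight a f) * x i
       = (\<Sum>s\<in>UNIV. v s * (\<Sum>f | forest f \<and> root_of f s i. forest_weight a f))"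
proof -
  define G where "G s = (\<Sum>f | forest f \<and> root_of f s i. forest_weight a f)" for s
  define D where "D = (\<Sum>f | forest f. forest_weight a f)"
  have first: "(\<Sum>w\<in>UNIV. a s w) * G s = (\<Sum>w\<in>-{s}. a s w * G w) + (if i = s then a s s * D else 0)"
    for s unfolding G_def D_def by (rule forest_first_step)
  have "(\<Sum>s\<in>UNIV. v s * G s) = (\<Sum>s\<in>UNIV. ((\<Sum>w\<in>UNIV. a s w) * x s - (\<Sum>w\<in>-{s}. a w s * x w)) * G s)"
    using eq by simp
  also have "\<dots> = (\<Sum>s\<in>UNIV. x s * ((\<Sum>w\<in>UNIV. a s w) * G s)) - (\<Sum>s\<in>UNIV. \<Sum>w\<in>-{s}. a w s * x w * G s)"
    by (simp add: algebra_simps sum_subtractf sum_distrib_left)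
  also have "(\<Sum>s\<in>UNIV. \<Sum>w\<in>-{s}. a w s * x w * G s) = (\<Sum>w\<in>UNIV. \<Sum>s\<in>-{w}. a w s * x w * G s)"
  proof -
    have "- {y} = {x. x \<noteq> y}" "- {y} = {x. y \<noteq> x}" for y :: 'a by auto
    thus ?thesis
      using sum.swap_restrict[of "UNIV::'a set" "UNIV::'a set" "\<lambda>s w. a w s * x w * G s" "\<lambda>s w. w \<noteq> s"]
      by simp
  qed
  also have "(\<Sum>s\<in>UNIV. x s * ((\<Sum>w\<in>UNIV. a s w) * G s)) - \<dots> 
      = (\<Sum>s\<in>UNIV. x s * (if i = s then a s s * D else 0))"
    unfolding first sum_subtractf[symmetric]
    by (intro sum.cong refl) (simp only: distrib_left sum_distrib_left, simp add: mult_ac)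
  also have "\<dots> = a i i * D * x i"
    by (subst sum.remove[of UNIV i]) auto
  finally show ?thesis by (simp add: G_def D_def)
qed

section \<open>Weights and numbers of edges\<close>

lemma card_edges: "card (edges f) = CARD('a) - card (roots f)" for f :: "'a::finite \<Rightarrow> 'a"
  unfolding edges_def by (subst card_image) (auto simp: inj_on_def Compl_eq_Diff_UNIV card_Diff_subset)

lemma forest_weight_edges:
  fixes f :: "'a::finite \<Rightarrow> 'a"
  shows "forest_weight (\<lambda>w s. if s = w then l else A s w) f
       = l ^ card (roots f) * (\<Prod>(s, w)\<in>edges f. A s w)"
proof -
  let ?g = "\<lambda>w. if f w = w then l else A (f w) w"
  have "forest_weight (\<lambda>w s. if s = w then l else A s w) f = prod ?g (- roots f) * prod ?g (roots f)"
    unfolding forest_weight_def Compl_eq_Diff_UNIV by (rule prod.subset_diff) auto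
  also have "prod ?g (roots f) = (\<Prod>w\<in>roots f. l)"
    by (rule prod.cong) (auto simp: roots_def)
  also have "prod ?g (- roots f) = (\<Prod>w\<in>- roots f. A (f w) w)"
    by (rule prod.cong) (auto simp: roots_def)
  also have "(\<Prod>w\<in>- roots f. A (f w) w) = (\<Prod>(s, w)\<in>edges f. A s w)"
    unfolding edges_def by (subst prod.reindex) (auto simp: inj_on_def)
  finally show ?thesis by (simp add: mult.commute)
qed

lemma card_roots_pos: "forest f \<Longrightarrow> card (roots f) > 0" for f :: "'a::finite \<Rightarrow> 'a"
  by (auto simp: card_gt_0_iff forest_def root_of_def roots_def)

lemma single_root_of:
  assumes "forest f" "roots f = {r}"
  shows "root_of f s i \<longleftrightarrow> i = r"
proof -
  obtain i' where i': "root_of f s i'" using assms(1) by (auto simp: forest_def)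
  moreover have "i' = r" using i' assms(2) by (auto simp: root_of_def roots_def)
  ultimately show ?thesis using root_of_unique by metis
qed

section \<open>Index pairs and the sums over them\<close>

text \<open>The terms for \<open>f\<close> are indexed by the states \<open>s\<close>, or by the root alone if \<open>f\<close> is a tree.\<close>

definition forest_terms :: "'a \<Rightarrow> (('a \<Rightarrow> 'a) \<times> 'a) set" where
  "forest_terms i = {(f, s). forest f \<and> root_of f s i \<and> (card (roots f) = 1 \<longrightarrow> s = i)}"

text \<open>Each \<open>s\<close> has a root in \<open>f\<close>, and that root is the index
  \<open>i\<close> of the family containing \<open>(f, s)\<close>; for a tree, \<open>s = i\<close>
  makes \<open>s\<close> the root itself.\<close>

lemma Union_forest_terms:
  "(\<Union>i. forest_terms i) = {(f, s). forest f \<and> (card (roots f) = 1 \<longrightarrow> s \<in> roots f)}"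
proof (intro equalityI subsetI)
  fix x assume "x \<in> {(f :: 'a \<Rightarrow> 'a, s). forest f \<and> (card (roots f) = 1 \<longrightarrow> s \<in> roots f)}"
  then obtain f s where x: "x = (f, s)" "forest f" "card (roots f) = 1 \<longrightarrow> s \<in> roots f"
    by auto
  obtain r where "root_of f s r" using x(2) by (auto simp: forest_def)
  with x show "x \<in> (\<Union>i. forest_terms i)"
    by (auto simp: forest_terms_def roots_def root_of_root)
qed (auto simp: forest_terms_def roots_def root_of_def)

text \<open>For a tree, truncated subtraction gives \<open>p f = 0\<close>, and its single term
  absorbs the sum of \<open>v\<close> as a factor \<open>l\<close>. With at least two trees the
  terms agree one by one.\<close>

lemma sum_forest_terms:
  fixes v :: "'a::finite \<Rightarrow> real" and l :: real
  defines "p \<equiv> \<lambda>f. card (roots f) - 2" and "b \<equiv> \<lambda>f. if card (roots f) = 1 then 0 else 1"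
  assumes "(\<Sum>s\<in>UNIV. v s) = l"
  shows "l * (\<Sum>(f, s)\<in>forest_terms i. l ^ (p f + 1) * v s ^ b f * W f)
       = (\<Sum>s\<in>UNIV. v s * (\<Sum>f | forest f \<and> root_of f s i. l ^ card (roots f) * W f))"
proof -
  have eq: "forest_terms i = (SIGMA f:{f. forest f}. {s. root_of f s i \<and> (card (roots f) = 1 \<longrightarrow> s = i)})"
    by (auto simp: forest_terms_def)
  have "l * (\<Sum>(f, s)\<in>forest_terms i. l ^ (p f + 1) * v s ^ b f * W f)
      = (\<Sum>f | forest f. l * (\<Sum>s | root_of f s i \<and> (card (roots f) = 1 \<longrightarrow> s = i).
            l ^ (p f + 1) * v s ^ b f * W f))"
    unfolding eq sum_distrib_left by (subst sum.Sigma) (simp_all add: case_prod_beta)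
  also have "\<dots> = (\<Sum>f | forest f. \<Sum>s | root_of f s i. v s * (l ^ card (roots f) * W f))"
  proof (rule sum.cong, goal_cases)
    case (2 f)
    hence f: "forest f" by simp
    show ?case
    proof (cases "card (roots f) = 1")
      case True
      then obtain r where r: "roots f = {r}" by (auto simp: card_1_singleton_iff)
      note root = single_root_of[OF f r]
      show ?thesis
      proof (cases "i = r")
        case True
        thus ?thesis using r assms(3) unfolding root by (simp add: p_def b_def flip: sum_distrib_right)
      qed (simp add: root)
    next
      case False
      with card_roots_pos[OF f] have "card (roots f) = Suc (p f + 1)" by (simp add: p_def)
      thus ?thesis using False by (simp add: b_def sum_distrib_left mult_ac)
    qed
  qed simp
  also have "\<dots> = (\<Sum>s\<in>UNIV. \<Sum>f | forest f \<and> root_of f s i. v s * (l ^ card (roots f) * W f))"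
    using sum.swap_restrict[of "{f. forest f}" "UNIV :: 'a set"
        "\<lambda>f s. v s * (l ^ card (roots f) * W f)" "\<lambda>f s. root_of f s i"]
    by simp
  finally show ?thesis by (simp add: sum_distrib_left)
qed

text \<open>\<open>c f\<close> is the reciprocal of the number of pairs containing \<open>f\<close>.
  Since \<open>p f + b f\<close> is one less than the number of trees, the coefficient carries one
  more factor \<open>l\<close>.\<close>

lemma sum_Union_forest_terms:
  fixes l :: real
  defines "p \<equiv> \<lambda>f. card (roots f) - 2" and "b \<equiv> \<lambda>f. if card (roots f) = 1 then 0 else 1"
    and "c \<equiv> \<lambda>f :: 'a \<Rightarrow> 'a. if card (roots f) = 1 then 1 else 1 / real CARD('a)"
  shows "(\<Sum>(f, s)\<in>(\<Union>i. forest_terms (i :: 'a::finite)). (l * c f) * l ^ (p f + b f) * W f)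
       = (\<Sum>f | forest f. l ^ card (roots f) * W f)"
proof -
  have eq: "(\<Union>i. forest_terms (i :: 'a)) = (SIGMA f:{f. forest f}. {s. card (roots f) = 1 \<longrightarrow> s \<in> roots f})"
    unfolding Union_forest_terms by auto
  have "(\<Sum>(f, s)\<in>(\<Union>i. forest_terms (i :: 'a)). (l * c f) * l ^ (p f + b f) * W f)
      = (\<Sum>f | forest f. \<Sum>s | card (roots f) = 1 \<longrightarrow> s \<in> roots f. (l * c f) * l ^ (p f + b f) * W f)"
    unfolding eq by (rule sum.Sigma[symmetric]) auto
  also have "\<dots> = (\<Sum>f | forest f. l ^ card (roots f) * W f)"
  proof (rule sum.cong, goal_cases)
    case (2 f)
    show ?case
    proof (cases "card (roots f) = 1")
      case True
      thus ?thesis by (simp add: p_def b_def c_def)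
    next
      case False
      with card_roots_pos[of f] 2 have k: "card (roots f) = Suc (p f + b f)"
        by (simp add: p_def b_def)
      have "{s. card (roots f) = 1 \<longrightarrow> s \<in> roots f} = UNIV" "c f = 1 / real CARD('a)"
        using False by (simp_all add: c_def)
      thus ?thesis unfolding k by simp
    qed
  qed simp
  finally show ?thesis .
qed

lemma forest_id: "forest id"
  unfolding forest_def root_of_def by (metis id_apply reaches_refl)

lemma forest_const: "forest (\<lambda>_. i)"
  unfolding forest_def root_of_def using reaches_step[of "\<lambda>_. i"] by auto

lemma forest_terms_nonempty: "forest_terms i \<noteq> {}"
proof -
  \<comment> \<open>The star in which every state points to \<open>i\<close>.\<close>
  have "(\<lambda>_. i, i) \<in> forest_terms i"
    by (simp add: forest_terms_def forest_const root_of_root)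
  thus ?thesis by blast
qed

section \<open>The stationary distribution as a quotient of forest sums\<close>

lemma stationary_forest:
  fixes C M :: "real ^ 'm ^ 'm" and v \<pi> :: "real ^ 'm"
  assumes M: "M = (columnvector v :: real ^ 1 ^ 'm) ** (rowvector 1 :: real ^ 'm ^ 1) + C"
    and C: "\<And>w. (\<Sum>s\<in>UNIV. C $ s $ w) = 1 - l"
    and \<pi>: "stationary_distribution M \<pi>"
  shows "l * (\<Sum>f | forest f. l ^ card (roots f) * (\<Prod>(s, w)\<in>edges f. C $ s $ w)) * \<pi> $ i
       = (\<Sum>s\<in>UNIV. v $ s *
           (\<Sum>f | forest f \<and> root_of f s i. l ^ card (roots f) * (\<Prod>(s, w)\<in>edges f. C $ s $ w)))"
proof -
  \<comment> \<open>The diagonal entry \<open>l\<close> gives every root the weight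
    \<open>l\<close>. The arguments are (source, target), so the column sums of \<open>C\<close>
    yield the row sums of \<open>a\<close>.\<close>
  define a where "a = (\<lambda>w s. if s = w then l else C $ s $ w)"
  have "(\<Sum>w\<in>UNIV. a s w) * \<pi> $ s = v $ s + (\<Sum>w\<in>-{s}. a w s * \<pi> $ w)" for s
  proof -
    have "(\<Sum>w\<in>UNIV. a s w) = l + (\<Sum>w\<in>-{s}. C $ w $ s)"
      by (subst sum.remove[of UNIV s]) (auto simp: a_def Compl_eq_Diff_UNIV intro!: sum.cong)
    also have "\<dots> = 1 - C $ s $ s"
      using C[of s] by (simp add: sum.remove[of UNIV s] Compl_eq_Diff_UNIV)
    finally have out: "(\<Sum>w\<in>UNIV. a s w) = 1 - C $ s $ s" .
    have "M $ s $ w = v $ s + C $ s $ w" for w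
      by (simp add: M matrix_matrix_mult_def columnvector_def rowvector_def)
    moreover have "\<pi> $ s = (M *v \<pi>) $ s"
      using \<pi> by (simp add: stationary_distribution_def)
    ultimately have "\<pi> $ s = v $ s * (\<Sum>w\<in>UNIV. \<pi> $ w) + (\<Sum>w\<in>UNIV. C $ s $ w * \<pi> $ w)"
      by (simp add: matrix_vector_mult_def algebra_simps sum.distrib sum_distrib_left)
    hence "\<pi> $ s = v $ s + (\<Sum>w\<in>UNIV. C $ s $ w * \<pi> $ w)"
      using \<pi> by (simp add: stationary_distribution_def probability_vector_def)
    also have "(\<Sum>w\<in>UNIV. C $ s $ w * \<pi> $ w) = C $ s $ s * \<pi> $ s + (\<Sum>w\<in>-{s}. a w s * \<pi> $ w)"
      by (subst sum.remove[of UNIV s]) (auto simp: a_def Compl_eq_Diff_UNIV intro!: sum.cong)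
    finally show ?thesis unfolding out by (simp add: algebra_simps)
  qed
  from matrix_forest[of a "($) \<pi>" "($) v" i, OF this]
  show ?thesis
    unfolding a_def forest_weight_edges by simp
qed

theorem lemma4p11:
  assumes "CARD('m::finite) \<ge> 2"
  shows "\<exists>(F :: 'm \<Rightarrow> nat set) (p :: nat \<Rightarrow> nat) (b :: nat \<Rightarrow> nat) (q :: nat \<Rightarrow> 'm)
            (S :: nat \<Rightarrow> ('m \<times> 'm) set) (c :: nat \<Rightarrow> real).
     (\<forall>i. finite (F i) \<and> F i \<noteq> {}) \<and>
     (\<forall>j \<in> (\<Union>i. F i). b j \<in> {0, 1} \<and> p j \<le> CARD('m) - 2 \<and>
        card (S j) = CARD('m) - p j - b j - 1 \<and> c j > 0) \<and>
     (\<forall>(lam :: real) (v :: real ^ 'm) (C :: real ^ 'm ^ 'm) (M :: real ^ 'm ^ 'm) (\<pi> :: real ^ 'm).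
        transition_matrix M \<longrightarrow>
        M = (columnvector v :: real ^ 1 ^ 'm) ** (rowvector (1 :: real ^ 'm) :: real ^ 'm ^ 1) + C \<longrightarrow>
        (\<forall>s w. C $ s $ w > 0) \<longrightarrow> (\<forall>w. (\<Sum>s\<in>UNIV. C $ s $ w) = 1 - lam) \<longrightarrow>
        (\<forall>s. v $ s > 0) \<longrightarrow> (\<Sum>s\<in>UNIV. v $ s) = lam \<longrightarrow>
        stationary_distribution M \<pi> \<longrightarrow>
        (\<forall>i. \<pi> $ i =
           (\<Sum>j \<in> F i. lam ^ (p j + 1) * (v $ q j) ^ b j * (\<Prod>(s, w) \<in> S j. C $ s $ w)) /
           (\<Sum>j \<in> (\<Union>i. F i). (lam * c j) * lam ^ (p j + b j) * (\<Prod>(s, w) \<in> S j. C $ s $ w))))"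
proof -
  \<comment> \<open>Pairs (forest, state) are numbered by \<open>to_nat\<close>; \<open>f j\<close>
    and \<open>s j\<close> decode an index.\<close>
  define f s where "f = (\<lambda>j. fst (from_nat j :: ('m \<Rightarrow> 'm) \<times> 'm))"
    and "s = (\<lambda>j. snd (from_nat j :: ('m \<Rightarrow> 'm) \<times> 'm))"
  define F where "F i = to_nat ` (forest_terms i :: (('m \<Rightarrow> 'm) \<times> 'm) set)" for i
  \<comment> \<open>These depend only on the number of trees and on \<open>CARD('m)\<close>, so they
    are fixed before \<open>lam\<close>, \<open>v\<close> and \<open>C\<close>.\<close>
  define p b c where "p = (\<lambda>f :: 'm \<Rightarrow> 'm. card (roots f) - 2)"
    and "b = (\<lambda>f :: 'm \<Rightarrow> 'm. if card (roots f) = 1 then 0 else 1 :: nat)"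
    and "c = (\<lambda>f :: 'm \<Rightarrow> 'm. if card (roots f) = 1 then 1 else 1 / real CARD('m))"
  have sum_to_nat: "(\<Sum>j\<in>to_nat ` X. h (f j) (s j)) = (\<Sum>(f, s)\<in>X. h f s)"
    for X and h :: "('m \<Rightarrow> 'm) \<Rightarrow> 'm \<Rightarrow> real"
    by (simp add: sum.reindex f_def s_def case_prod_beta)
  have UF: "(\<Union>i. F i) = to_nat ` (\<Union>i. forest_terms i :: (('m \<Rightarrow> 'm) \<times> 'm) set)"
    by (auto simp: F_def)
  have fin: "finite (F i) \<and> F i \<noteq> {}" for i
    by (simp add: F_def forest_terms_nonempty)
  have param: "b (f j) \<in> {0, 1} \<and> p (f j) \<le> CARD('m) - 2 \<and>
        card (edges (f j)) = CARD('m) - p (f j) - b (f j) - 1 \<and> c (f j) > 0"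
    if "j \<in> (\<Union>i. F i)" for j
  proof -
    have "forest (f j)"
      using that unfolding UF Union_forest_terms by (auto simp: f_def)
    hence "card (roots (f j)) > 0" by (rule card_roots_pos)
    moreover have "card (roots (f j)) \<le> CARD('m)" by (intro card_mono) auto
    \<comment> \<open>With \<open>k\<close> roots there are \<open>CARD('m) - k\<close> edges, and
      \<open>k = p + b + 1\<close> both for \<open>k = 1\<close> and for larger
      \<open>k\<close>.\<close>
    ultimately show ?thesis by (auto simp: p_def b_def c_def card_edges)
  qed
  have formula: "\<pi> $ i =
       (\<Sum>j \<in> F i. lam ^ (p (f j) + 1) * (v $ s j) ^ b (f j) * (\<Prod>(s, w) \<in> edges (f j). C $ s $ w)) /
       (\<Sum>j \<in> (\<Union>i. F i). (lam * c (f j)) * lam ^ (p (f j) + b (f j)) * (\<Prod>(s, w) \<in> edges (f j). C $ s $ w))"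
    if M: "M = (columnvector v :: real ^ 1 ^ 'm) ** (rowvector (1 :: real ^ 'm) :: real ^ 'm ^ 1) + C"
      and C: "\<forall>s w. C $ s $ w > 0" "\<forall>w. (\<Sum>s\<in>UNIV. C $ s $ w) = 1 - lam"
      and v: "\<forall>s. v $ s > 0" "(\<Sum>s\<in>UNIV. v $ s) = lam"
      and \<pi>: "stationary_distribution M \<pi>"
    for lam :: real and v \<pi> :: "real ^ 'm" and C M :: "real ^ 'm ^ 'm" and i
  proof -
    let ?W = "\<lambda>f. \<Prod>(s, w) \<in> edges f. C $ s $ w"
    let ?D = "\<Sum>f | forest f. lam ^ card (roots f) * ?W f"
    have "lam > 0" using v by (metis UNIV_not_empty finite sum_pos)
    \<comment> \<open>All summands are positive, and the edgeless forest \<open>id\<close> shows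
      that there is at least one.\<close>
    have "?D > 0"
      using \<open>lam > 0\<close> C(1) forest_id by (intro sum_pos) (auto intro!: mult_pos_pos prod_pos)
    have "lam * ?D * \<pi> $ i = lam * (\<Sum>(f, s)\<in>forest_terms i. lam ^ (p f + 1) * (v $ s) ^ b f * ?W f)"
      unfolding p_def b_def sum_forest_terms[of "($) v", OF v(2)]
      using stationary_forest[OF M _ \<pi>] C(2) by blast
    hence "\<pi> $ i = (\<Sum>(f, s)\<in>forest_terms i. lam ^ (p f + 1) * (v $ s) ^ b f * ?W f) / ?D"
      using \<open>lam > 0\<close> \<open>?D > 0\<close> by (simp add: field_simps)
    also have "(\<Sum>(f, s)\<in>forest_terms i. lam ^ (p f + 1) * (v $ s) ^ b f * ?W f)
        = (\<Sum>j \<in> F i. lam ^ (p (f j) + 1) * (v $ s j) ^ b (f j) * ?W (f j))"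
      unfolding F_def by (rule sum_to_nat[symmetric])
    also have "?D = (\<Sum>j \<in> (\<Union>i. F i). (lam * c (f j)) * lam ^ (p (f j) + b (f j)) * ?W (f j))"
      unfolding UF sum_to_nat[of "\<lambda>f _. lam * c f * lam ^ (p f + b f) * ?W f"]
      unfolding p_def b_def c_def by (rule sum_Union_forest_terms[symmetric])
    finally show ?thesis .
  qed
  show ?thesis
    by (rule exI[of _ F], rule exI[of _ "\<lambda>j. p (f j)"], rule exI[of _ "\<lambda>j. b (f j)"],
        rule exI[of _ s], rule exI[of _ "\<lambda>j. edges (f j)"], rule exI[of _ "\<lambda>j. c (f j)"], intro conjI)
       (rule allI, rule fin, rule ballI, erule param, intro allI impI, (rule formula; assumption))
qed

end
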